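(* Let $G$ be a connected graph. Then $tmc(G)=3$ if and only if $G$ is a path.
   Context: All graphs are simple, finite and undirected. A graph is total-colored if all its edges and all its vertices are assigned colors. A path in a total-colored graph is a total monochromatic path if all its edges and all its internal vertices have the same color. A total-coloring of a graph is a TMC-coloring (total monochromatically-connecting coloring) if any two vertices of the graph are connected by a total monochromatic path. For a connected graph $G$, the total monochromatic connection number $tmc(G)$ is the maximum number of colors used in a TMC-coloring of $G$. *)

theory Defs
  imports Main
begin

definition simple_graph :: "'a set \<Rightarrow> 'a set set \<Rightarrow> bool" where
  "simple_graph V E \<longleftrightarrow> finite V \<and> (\<forall>e\<in>E. e \<subseteq> V \<and> card e = 2)"

definition path_edges :: "'a list \<Rightarrow> 'a set set" where
  "path_edges p = {{p ! i, p ! Suc i} | i. Suc i < length p}"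

definition internal_vertices :: "'a list \<Rightarrow> 'a set" where
  "internal_vertices p = set (butlast (tl p))"

definition path_between :: "'a set \<Rightarrow> 'a set set \<Rightarrow> 'a \<Rightarrow> 'a list \<Rightarrow> 'a \<Rightarrow> bool" where
  "path_between V E u p v \<longleftrightarrow>
     p \<noteq> [] \<and> hd p = u \<and> last p = v \<and> distinct p \<and> set p \<subseteq> V \<and> path_edges p \<subseteq> E"

definition connected_graph :: "'a set \<Rightarrow> 'a set set \<Rightarrow> bool" where
  "connected_graph V E \<longleftrightarrow> V \<noteq> {} \<and> (\<forall>u\<in>V. \<forall>v\<in>V. \<exists>p. path_between V E u p v)"

(* A total-coloring is a pair of functions, vc on vertices and ec on edges, sharing one set
   of colors; their values outside V and E are irrelevant. *)

definition total_monochromatic :: "('a \<Rightarrow> 'c) \<Rightarrow> ('a set \<Rightarrow> 'c) \<Rightarrow> 'a list \<Rightarrow> bool" where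
  "total_monochromatic vc ec p \<longleftrightarrow>
     (\<exists>c. (\<forall>e\<in>path_edges p. ec e = c) \<and> (\<forall>x\<in>internal_vertices p. vc x = c))"

definition tmc_coloring ::
  "'a set \<Rightarrow> 'a set set \<Rightarrow> ('a \<Rightarrow> 'c) \<Rightarrow> ('a set \<Rightarrow> 'c) \<Rightarrow> bool" where
  "tmc_coloring V E vc ec \<longleftrightarrow>
     (\<forall>u\<in>V. \<forall>v\<in>V. \<exists>p. path_between V E u p v \<and> total_monochromatic vc ec p)"

definition colors_used :: "'a set \<Rightarrow> 'a set set \<Rightarrow> ('a \<Rightarrow> 'c) \<Rightarrow> ('a set \<Rightarrow> 'c) \<Rightarrow> 'c set" where
  "colors_used V E vc ec = vc ` V \<union> ec ` E"

(* For a finite connected graph the set below is nonempty (color everything alike) and bounded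
   by card V + card E, so Max is meaningful; natural numbers supply enough colors. *)
definition tmc :: "'a set \<Rightarrow> 'a set set \<Rightarrow> nat" where
  "tmc V E = Max {card (colors_used V E vc ec) | (vc :: 'a \<Rightarrow> nat) (ec :: 'a set \<Rightarrow> nat).
                    tmc_coloring V E vc ec}"

(* The graph P_n with n >= 2. The one-vertex graph is not counted as a path: it has no edge
   and only one item to color, so its tmc is 1. *)
definition path_graph :: "'a set \<Rightarrow> 'a set set \<Rightarrow> bool" where
  "path_graph V E \<longleftrightarrow>
     (\<exists>p. length p \<ge> 2 \<and> distinct p \<and> V = set p \<and> E = path_edges p)"

end

(* Given a spanning tree of G, color its edges and internal vertices alike and give each leaf and
   each edge off the tree a color of its own. This uses 1 + #leaves + #(edges off the tree) colors,
   which, a single vertex aside, is at least 4 unless G is a tree with two leaves, i.e. a path.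
   In a path the only connection between the two ends runs through everything else, so at most
   3 colors can occur. *)
theory Submission
  imports Defs
begin

section \<open>Paths\<close>

lemma path_edges_singleton: "path_edges [x] = {}"
  by (simp add: path_edges_def)

lemma path_edges_Cons: "path_edges (x # y # zs) = insert {x, y} (path_edges (y # zs))"
proof (intro set_eqI iffI)
  fix e assume "e \<in> path_edges (x # y # zs)"
  then obtain i where i: "Suc i < length (x # y # zs)"
    "e = {(x # y # zs) ! i, (x # y # zs) ! Suc i}"
    unfolding path_edges_def by blast
  then show "e \<in> insert {x, y} (path_edges (y # zs))"
    by (cases i) (auto simp: path_edges_def)
next
  fix e assume "e \<in> insert {x, y} (path_edges (y # zs))"
  then consider "e = {x, y}" | i where "Suc i < length (y # zs)"
    "e = {(y # zs) ! i, (y # zs) ! Suc i}"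
    unfolding path_edges_def by blast
  then show "e \<in> path_edges (x # y # zs)"
  proof cases
    case 1
    then show ?thesis unfolding path_edges_def by force
  next
    case (2 i)
    then have "Suc (Suc i) < length (x # y # zs)"
      "e = {(x # y # zs) ! Suc i, (x # y # zs) ! Suc (Suc i)}" by auto
    then show ?thesis unfolding path_edges_def by blast
  qed
qed

lemma path_edges_snoc:
  "p \<noteq> [] \<Longrightarrow> path_edges (p @ [x]) = insert {last p, x} (path_edges p)"
proof (induction p)
  case (Cons a p)
  then show ?case
    by (cases p) (auto simp: path_edges_Cons path_edges_singleton)
qed simp

lemma path_edges_rev: "path_edges (rev p) = path_edges p"
proof (induction p)
  case (Cons a p)
  show ?case
  proof (cases "p = []")
    case False
    then obtain b q where p: "p = b # q" by (cases p) auto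
    have "path_edges (rev p @ [a]) = insert {b, a} (path_edges (rev p))"
      using p by (subst path_edges_snoc) auto
    then show ?thesis using p Cons.IH by (simp add: path_edges_Cons insert_commute)
  qed simp
qed simp

lemma path_edges_subset_set: "e \<in> path_edges p \<Longrightarrow> e \<subseteq> set p"
  by (auto simp: path_edges_def)

lemma finite_path_edges: "finite (path_edges p)"
  by (rule finite_subset[of _ "Pow (set p)"]) (auto dest: path_edges_subset_set)

lemma internal_verticesI:
  assumes "x \<in> set p" "x \<noteq> hd p" "x \<noteq> last p"
  shows "x \<in> internal_vertices p"
proof (cases p)
  case (Cons a q)
  with assms have "x \<in> set q" "q \<noteq> []" by auto
  moreover have "x \<noteq> last q" using assms Cons \<open>q \<noteq> []\<close> by simp
  ultimately have "x \<in> set (butlast q)"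
    by (metis append_butlast_last_id in_set_butlast_appendI rotate1.simps(2) set_ConsD set_rotate1)
  then show ?thesis using Cons by (simp add: internal_vertices_def)
qed (use assms in simp)

lemma path_between_sym: "path_between V E u p v \<Longrightarrow> path_between V E v (rev p) u"
  by (simp add: path_between_def path_edges_rev hd_rev last_rev)

lemma path_between_mono:
  "path_between V E u p v \<Longrightarrow> V \<subseteq> V' \<Longrightarrow> E \<subseteq> E' \<Longrightarrow> path_between V' E' u p v"
  by (auto simp: path_between_def)

lemma path_between_snoc:
  "path_between V E u p a \<Longrightarrow> b \<notin> V \<Longrightarrow>
    path_between (insert b V) (insert {a, b} E) u (p @ [b]) b"
  by (auto simp: path_between_def path_edges_snoc)

text \<open>The tool for cut arguments: it is applied to an initial segment of a path and to the
  vertex set of a subtree. The induction stops at the first step that leaves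
  \<open>P\<close>.\<close>

lemma exists_crossing_step:
  assumes "p \<noteq> []" "P (hd p)" "\<not> P (last p)"
  shows "\<exists>a b. P a \<and> \<not> P b \<and> b \<in> set p \<and> {a, b} \<in> path_edges p"
  using assms
proof (induction p)
  case (Cons x p)
  then obtain y q where p: "p = y # q" by (cases p) auto
  show ?case
  proof (cases "P y")
    case True
    then show ?thesis using Cons p by (auto simp: path_edges_Cons)
  next
    case False
    then show ?thesis using Cons p by (auto simp: path_edges_Cons)
  qed
qed simp

lemma simple_graph_finite_edges: "simple_graph V E \<Longrightarrow> finite E"
  unfolding simple_graph_def by (metis PowI finite_Pow_iff finite_subset subsetI)

section \<open>Bounds on the total monochromatic connection number\<close>

lemma finite_colors_used:
  "simple_graph V E \<Longrightarrow> finite (colors_used V E vc ec)"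
  by (simp add: colors_used_def simple_graph_finite_edges) (simp add: simple_graph_def)

lemma finite_tmc_candidates:
  assumes "simple_graph V E"
  shows "finite {card (colors_used V E vc ec) | (vc :: 'a \<Rightarrow> nat) (ec :: 'a set \<Rightarrow> nat).
                    tmc_coloring V E vc ec}"
proof (rule finite_subset)
  have fin: "finite V" "finite E"
    using assms simple_graph_finite_edges by (auto simp: simple_graph_def)
  have "card (colors_used V E vc ec) \<le> card V + card E"
    for vc :: "'a \<Rightarrow> nat" and ec :: "'a set \<Rightarrow> nat"
    unfolding colors_used_def
    by (meson add_mono card_Un_le card_image_le fin order_trans)
  then show "{card (colors_used V E vc ec) | (vc :: 'a \<Rightarrow> nat) (ec :: 'a set \<Rightarrow> nat).
      tmc_coloring V E vc ec} \<subseteq> {..card V + card E}"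
    by auto
qed simp

lemma tmc_ge:
  fixes vc :: "'a \<Rightarrow> nat" and ec :: "'a set \<Rightarrow> nat"
  assumes "simple_graph V E" "tmc_coloring V E vc ec"
  shows "card (colors_used V E vc ec) \<le> tmc V E"
  unfolding tmc_def by (rule Max_ge[OF finite_tmc_candidates[OF assms(1)]]) (use assms in blast)

lemma tmc_attained:
  fixes V :: "'a set"
  assumes "simple_graph V E" "connected_graph V E"
  obtains vc :: "'a \<Rightarrow> nat" and ec :: "'a set \<Rightarrow> nat"
  where "tmc_coloring V E vc ec" "tmc V E = card (colors_used V E vc ec)"
proof -
  let ?S = "{card (colors_used V E vc ec) | (vc :: 'a \<Rightarrow> nat) (ec :: 'a set \<Rightarrow> nat).
                    tmc_coloring V E vc ec}"
  have "tmc_coloring V E (\<lambda>_. 0 :: nat) (\<lambda>_. 0)"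
    using assms(2) by (auto simp: tmc_coloring_def connected_graph_def total_monochromatic_def)
  then have "?S \<noteq> {}" by blast
  then have "tmc V E \<in> ?S"
    unfolding tmc_def by (rule Max_in[OF finite_tmc_candidates[OF assms(1)]])
  with that show thesis by blast
qed

text \<open>Degree one is phrased through a unique incident edge, which lets two edges at a leaf be
  equated directly.\<close>

definition leaves :: "'a set \<Rightarrow> 'a set set \<Rightarrow> 'a set" where
  "leaves V E = {x \<in> V. \<exists>!e. e \<in> E \<and> x \<in> e}"

text \<open>An internal vertex lies on the path edges before and after it. At a leaf these would
  coincide, and then its two neighbors on the path would be equal, against distinctness.\<close>

lemma internal_vertices_not_leaves:
  assumes "distinct p" "path_edges p \<subseteq> E" "x \<in> internal_vertices p"
  shows "x \<notin> leaves V E"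
proof
  assume "x \<in> leaves V E"
  then have uniq: "e = e'" if "e \<in> E" "e' \<in> E" "x \<in> e" "x \<in> e'" for e e'
    using that by (auto simp: leaves_def)
  obtain i where i: "i < length (butlast (tl p))" "x = butlast (tl p) ! i"
    using assms(3) by (metis in_set_conv_nth internal_vertices_def)
  then have len: "Suc (Suc i) < length p" by simp
  have x: "x = p ! Suc i" using i by (simp add: nth_butlast nth_tl)
  have "{p ! i, p ! Suc i} \<in> path_edges p" "{p ! Suc i, p ! Suc (Suc i)} \<in> path_edges p"
    using len by (auto simp: path_edges_def)
  then have "{p ! i, p ! Suc i} = {p ! Suc i, p ! Suc (Suc i)}"
    using uniq assms(2) x by blast
  then have "p ! i = p ! Suc (Suc i)" by (auto simp: doubleton_eq_iff)
  then show False using assms(1) len by (simp add: nth_eq_iff_index_eq)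
qed

text \<open>All of \<open>F\<close> and its non-leaves get color 0, every other vertex or edge a
  color of its own; paths inside \<open>F\<close> have no leaf of \<open>F\<close> as an internal
  vertex. No tree structure is asked of \<open>F\<close>, so \<open>E\<close> itself can take its
  place.\<close>

lemma tmc_ge_leaves:
  fixes V :: "'a set"
  assumes G: "simple_graph V E" and F: "connected_graph V F" "F \<subseteq> E" "F \<noteq> {}"
  shows "1 + card (leaves V F) + card (E - F) \<le> tmc V E"
proof -
  let ?L = "leaves V F"
  have fin: "finite ?L" "finite (E - F)"
    using G simple_graph_finite_edges by (auto simp: simple_graph_def leaves_def)
  obtain f where f: "bij_betw f ?L {0..<card ?L}"
    using ex_bij_betw_finite_nat[OF fin(1)] by blast
  obtain g where g: "bij_betw g (E - F) {0..<card (E - F)}"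
    using ex_bij_betw_finite_nat[OF fin(2)] by blast
  \<comment> \<open>Color 0 is the common one; leaves take 1 to \<open>card ?L\<close>, and edges
    outside \<open>F\<close> the next \<open>card (E - F)\<close> numbers.\<close>
  define vc where "vc x = (if x \<in> ?L then Suc (f x) else 0)" for x
  define ec where "ec e = (if e \<in> F then 0 else Suc (card ?L + g e))" for e
  have "tmc_coloring V E vc ec"
    unfolding tmc_coloring_def
  proof (intro ballI)
    fix u v assume "u \<in> V" "v \<in> V"
    then obtain p where p: "path_between V F u p v"
      using F(1) unfolding connected_graph_def by blast
    have "vc x = 0" if "x \<in> internal_vertices p" for x
      using internal_vertices_not_leaves[OF _ _ that, of F V] p
      by (simp add: vc_def path_between_def)
    moreover have "ec e = 0" if "e \<in> path_edges p" for e
      using that p by (auto simp: ec_def path_between_def)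
    ultimately have "total_monochromatic vc ec p"
      by (auto simp: total_monochromatic_def)
    with path_between_mono[OF p subset_refl F(2)]
    show "\<exists>p. path_between V E u p v \<and> total_monochromatic vc ec p" by blast
  qed
  then have "card (colors_used V E vc ec) \<le> tmc V E" by (rule tmc_ge[OF G])
  moreover have "{..card ?L + card (E - F)} \<subseteq> colors_used V E vc ec"
  proof
    fix k assume k: "k \<in> {..card ?L + card (E - F)}"
    consider "k = 0" | j where "k = Suc j" "j < card ?L"
      | j where "k = Suc (card ?L + j)" "j < card (E - F)"
    proof (cases k)
      case (Suc j)
      with k that(2)[of j] that(3)[of "j - card ?L"] show ?thesis
        by (cases "j < card ?L") auto
    qed (use that in simp)
    then show "k \<in> colors_used V E vc ec"
    proof cases
      case 1
      \<comment> \<open>Color 0 is found on an edge because it may occur on no vertex: in the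
        one-edge graph both ends are leaves.\<close>
      obtain e where "e \<in> F" using F(3) by blast
      then have "ec e = 0" "e \<in> E" using F(2) by (auto simp: ec_def)
      then show ?thesis using 1 by (force simp: colors_used_def)
    next
      case (2 j)
      then have "j \<in> f ` ?L" using f by (simp add: bij_betw_def)
      then obtain x where "x \<in> ?L" "f x = j" by blast
      then have "vc x = k" "x \<in> V" using 2 by (auto simp: vc_def leaves_def)
      then show ?thesis by (force simp: colors_used_def)
    next
      case (3 j)
      then have "j \<in> g ` (E - F)" using g by (simp add: bij_betw_def)
      then obtain e where "e \<in> E - F" "g e = j" by blast
      then have "ec e = k" "e \<in> E" using 3 by (auto simp: ec_def)
      then show ?thesis by (force simp: colors_used_def)
    qed
  qed
  then have "1 + card ?L + card (E - F) \<le> card (colors_used V E vc ec)"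
    using card_mono[OF finite_colors_used[OF G]] by fastforce
  ultimately show ?thesis by linarith
qed

section \<open>Path graphs\<close>

lemma hd_in_leaves:
  assumes "2 \<le> length p" "distinct p"
  shows "hd p \<in> leaves (set p) (path_edges p)"
proof -
  obtain x y zs where p: "p = x # y # zs"
    using assms(1) by (metis One_nat_def Suc_1 Suc_le_length_iff)
  have "x \<notin> e" if "e \<in> path_edges (y # zs)" for e
    using path_edges_subset_set[OF that] assms(2) p by auto
  then show ?thesis by (auto simp: leaves_def p path_edges_Cons)
qed

lemma last_in_leaves:
  assumes "2 \<le> length p" "distinct p"
  shows "last p \<in> leaves (set p) (path_edges p)"
  using hd_in_leaves[of "rev p"] assms by (simp add: hd_rev path_edges_rev)

lemma hd_neq_last: "2 \<le> length p \<Longrightarrow> distinct p \<Longrightarrow> hd p \<noteq> last p"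
  by (cases p) (auto simp: Suc_le_eq)

text \<open>Deleting any edge of \<open>p\<close> separates its first vertex from its last, so a
  connection of the two that stays in \<open>p\<close> has to use that edge.\<close>

lemma path_edges_subset_of_end_to_end:
  assumes p: "distinct p" "2 \<le> length p"
    and q: "path_between (set p) (path_edges p) (hd p) q (last p)"
  shows "path_edges p \<subseteq> path_edges q"
proof
  fix e assume "e \<in> path_edges p"
  then obtain i where i: "Suc i < length p" "e = {p ! i, p ! Suc i}"
    unfolding path_edges_def by blast
  have inj: "p ! j = p ! k \<longleftrightarrow> j = k" if "j < length p" "k < length p" for j k
    using p(1) that by (simp add: nth_eq_iff_index_eq)
  \<comment> \<open>\<open>P\<close> marks the initial segment of \<open>p\<close> up to the chosen
    edge; \<open>q\<close> starts in it and ends outside.\<close>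
  define P where "P x \<longleftrightarrow> (\<exists>j\<le>i. x = p ! j)" for x
  have P: "P (p ! j) \<longleftrightarrow> j \<le> i" if "j < length p" for j
    using inj that i(1) by (auto simp: P_def)
  have ne: "p \<noteq> []" using p(2) by auto
  have "P (hd q)" using q ne by (auto simp: path_between_def P_def hd_conv_nth)
  moreover have "\<not> P (last q)"
    using q ne i(1) P[of "length p - 1"] by (simp add: path_between_def last_conv_nth)
  moreover have "q \<noteq> []" using q by (simp add: path_between_def)
  ultimately obtain a b where ab: "P a" "\<not> P b" "{a, b} \<in> path_edges q"
    using exists_crossing_step[of q P] by blast
  then have "{a, b} \<in> path_edges p" using q by (auto simp: path_between_def)
  then obtain k where k: "Suc k < length p" "{a, b} = {p ! k, p ! Suc k}"
    unfolding path_edges_def by blast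
  then have "a = p ! k \<and> b = p ! Suc k \<or> a = p ! Suc k \<and> b = p ! k"
    by (simp add: doubleton_eq_iff)
  \<comment> \<open>The first alternative gives \<open>k \<le> i < Suc k\<close>; the second would
    put the later vertex inside the segment and the earlier one outside.\<close>
  with ab P[of k] P[of "Suc k"] k(1) have "k = i" by auto
  then show "e \<in> path_edges q" using ab(3) k(2) i(2) by simp
qed

text \<open>Applied to the two ends, the coloring condition gives a monochromatic path containing
  all edges of \<open>p\<close>, hence all its vertices. Only the two ends can deviate from its
  color.\<close>

lemma card_colors_used_path_le:
  assumes p: "distinct p" "2 \<le> length p"
    and c: "tmc_coloring (set p) (path_edges p) vc ec"
  shows "card (colors_used (set p) (path_edges p) vc ec) \<le> 3"
proof -
  have ne: "p \<noteq> []" using p(2) by auto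
  then obtain q where q: "path_between (set p) (path_edges p) (hd p) q (last p)"
    and mono: "total_monochromatic vc ec q"
    using c unfolding tmc_coloring_def by (meson hd_in_set last_in_set)
  have sub: "path_edges p \<subseteq> path_edges q"
    by (rule path_edges_subset_of_end_to_end[OF p q])
  obtain c where ce: "\<forall>e\<in>path_edges q. ec e = c" and cv: "\<forall>x\<in>internal_vertices q. vc x = c"
    using mono unfolding total_monochromatic_def by blast
  have "vc x \<in> {c, vc (hd p), vc (last p)}" if x: "x \<in> set p" for x
  proof (cases "x = hd p \<or> x = last p")
    case False
    obtain i where i: "i < length p" "x = p ! i" using x by (metis in_set_conv_nth)
    \<comment> \<open>Any vertex but the last starts an edge of \<open>p\<close>; this edge lies on
      \<open>q\<close>, and so does the vertex.\<close>
    have "i \<noteq> length p - 1" using False i ne by (auto simp: last_conv_nth)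
    then have "Suc i < length p" using i by simp
    then have "{x, p ! Suc i} \<in> path_edges p" using i by (auto simp: path_edges_def)
    then have "x \<in> set q" using sub path_edges_subset_set by blast
    then have "x \<in> internal_vertices q"
      using False q by (auto simp: path_between_def intro!: internal_verticesI)
    then show ?thesis using cv by simp
  qed auto
  then have "colors_used (set p) (path_edges p) vc ec \<subseteq> {c, vc (hd p), vc (last p)}"
    using sub ce by (auto simp: colors_used_def)
  then have "card (colors_used (set p) (path_edges p) vc ec) \<le> card {c, vc (hd p), vc (last p)}"
    by (rule card_mono[rotated]) simp
  also have "\<dots> \<le> 3" by (rule card_insert_le_m1) (auto intro: card_insert_le_m1)
  finally show ?thesis .
qed

text \<open>The two ends are distinct leaves. The bound serves for path graphs themselves and for
  spanning paths that are proper subgraphs.\<close>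

lemma path_graph_card_leaves:
  assumes "path_graph V E"
  shows "2 \<le> card (leaves V E)"
proof -
  obtain p where p: "2 \<le> length p" "distinct p" "V = set p" "E = path_edges p"
    using assms unfolding path_graph_def by blast
  have "finite (leaves V E)" using p(3) by (simp add: leaves_def)
  moreover have "{hd p, last p} \<subseteq> leaves V E"
    using hd_in_leaves last_in_leaves p by blast
  ultimately have "card {hd p, last p} \<le> card (leaves V E)" by (rule card_mono)
  then show ?thesis using hd_neq_last[OF p(1,2)] by simp
qed

section \<open>Spanning trees\<close>

text \<open>Trees are generated from a single vertex by attaching pendant vertices. Acyclicity is
  thus built in, and the number of leaves can be followed by induction.\<close>

inductive tree :: "'a set \<Rightarrow> 'a set set \<Rightarrow> bool" where
  single: "tree {v} {}"
| grow: "tree W F \<Longrightarrow> a \<in> W \<Longrightarrow> b \<notin> W \<Longrightarrow> tree (insert b W) (insert {a, b} F)"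

lemma tree_simple_graph: "tree W F \<Longrightarrow> simple_graph W F"
  by (induction rule: tree.induct) (auto simp: simple_graph_def card_2_iff)

lemma tree_no_edges: "tree W {} \<Longrightarrow> \<exists>v. W = {v}"
  by (cases rule: tree.cases) auto

text \<open>A path to the new vertex \<open>b\<close> is a path to \<open>a\<close> prolonged by the
  new edge; reversal gives the paths from \<open>b\<close>.\<close>

lemma tree_connected: "tree W F \<Longrightarrow> connected_graph W F"
proof (induction rule: tree.induct)
  case (single v)
  have "path_between {v} {} v [v] v" by (simp add: path_between_def path_edges_singleton)
  then show ?case by (auto simp: connected_graph_def)
next
  case (grow W F a b)
  let ?P = "\<lambda>u v. \<exists>p. path_between (insert b W) (insert {a, b} F) u p v"
  have old: "?P u v" if "u \<in> W" "v \<in> W" for u v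
    using grow.IH that path_between_mono[of W F u _ v "insert b W" "insert {a, b} F"]
    unfolding connected_graph_def by blast
  have new: "?P u b" if "u \<in> W" for u
    using grow that path_between_snoc unfolding connected_graph_def by metis
  have new': "?P b u" if "u \<in> W" for u
    using new[OF that] path_between_sym by metis
  have "path_between (insert b W) (insert {a, b} F) b [b] b"
    by (simp add: path_between_def path_edges_singleton)
  with old new new' show ?case unfolding connected_graph_def by blast
qed

text \<open>The new edge touches only \<open>a\<close> and \<open>b\<close>, so among the old leaves
  only \<open>a\<close> can lose that status. Inclusion may be strict: if \<open>a\<close> had no
  edge before, it becomes a leaf itself.\<close>

lemma leaves_grow:
  assumes "simple_graph W F" "a \<in> W" "b \<notin> W"
  shows "insert b (leaves W F - {a}) \<subseteq> leaves (insert b W) (insert {a, b} F)"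
proof -
  have b: "b \<notin> e" if "e \<in> F" for e using assms that by (auto simp: simple_graph_def)
  have "b \<in> leaves (insert b W) (insert {a, b} F)"
    unfolding leaves_def using b by blast
  moreover have "x \<in> leaves (insert b W) (insert {a, b} F)" if "x \<in> leaves W F" "x \<noteq> a" for x
  proof -
    have x: "x \<in> W" "\<exists>!e. e \<in> F \<and> x \<in> e" using that(1) by (simp_all add: leaves_def)
    then have "x \<notin> {a, b}" using that(2) assms(3) by auto
    then have "(e \<in> insert {a, b} F \<and> x \<in> e) \<longleftrightarrow> (e \<in> F \<and> x \<in> e)" for e by auto
    then show ?thesis using x by (simp add: leaves_def)
  qed
  ultimately show ?thesis by blast
qed

text \<open>Growing a path at an end gives a path, and at an inner vertex a third leaf. Once there
  are three leaves, further growth never lowers their number.\<close>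

lemma tree_path_or_leaves:
  assumes "tree W F" "F \<noteq> {}"
  shows "path_graph W F \<or> 3 \<le> card (leaves W F)"
  using assms
proof (induction rule: tree.induct)
  case (grow W F a b)
  let ?W = "insert b W" and ?F = "insert {a, b} F"
  have simple: "simple_graph W F" using grow.hyps(1) by (rule tree_simple_graph)
  have sub: "insert b (leaves W F - {a}) \<subseteq> leaves ?W ?F"
    by (rule leaves_grow[OF simple grow.hyps(2,3)])
  have fin: "finite (leaves W F)" "finite (leaves ?W ?F)"
    using simple by (auto simp: simple_graph_def leaves_def)
  have b: "b \<notin> leaves W F" using grow.hyps by (simp add: leaves_def)
  \<comment> \<open>The induction hypothesis says nothing about a single vertex, so attaching the
    first edge is treated apart.\<close>
  consider "F = {}" | "path_graph W F" | "3 \<le> card (leaves W F)" using grow.IH by blast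
  then show ?case
  proof cases
    case 1
    then have W: "W = {a}" using tree_no_edges grow.hyps by blast
    have "2 \<le> length [a, b] \<and> distinct [a, b] \<and> ?W = set [a, b] \<and> ?F = path_edges [a, b]"
      using 1 W grow.hyps by (auto simp: path_edges_Cons path_edges_singleton)
    then show ?thesis unfolding path_graph_def by blast
  next
    case 2
    then obtain p where p: "2 \<le> length p" "distinct p" "W = set p" "F = path_edges p"
      unfolding path_graph_def by blast
    have extend: "path_graph ?W ?F"
      if r: "2 \<le> length r" "distinct r" "W = set r" "F = path_edges r" "a = last r" for r
    proof -
      have "r \<noteq> []" using r(1) by auto
      then have "2 \<le> length (r @ [b]) \<and> distinct (r @ [b]) \<and> ?W = set (r @ [b])
          \<and> ?F = path_edges (r @ [b])"
        using r grow.hyps by (auto simp: path_edges_snoc)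
      then show ?thesis unfolding path_graph_def by blast
    qed
    consider "a = last p" | "a = hd p" | "a \<noteq> hd p" "a \<noteq> last p" by blast
    then show ?thesis
    proof cases
      case 1
      then show ?thesis using extend p by blast
    next
      case 2
      \<comment> \<open>The edge set of a path does not depend on direction, so attaching at the
        front is attaching at the end of the reversed list.\<close>
      then show ?thesis
        using extend[of "rev p"] p by (simp add: path_edges_rev last_rev)
    next
      case 3
      have "{b, hd p, last p} \<subseteq> leaves ?W ?F"
        using sub 3 hd_in_leaves[OF p(1,2)] last_in_leaves[OF p(1,2)] p(3,4) by blast
      then have "card {b, hd p, last p} \<le> card (leaves ?W ?F)" by (rule card_mono[OF fin(2)])
      moreover have "b \<noteq> hd p" "b \<noteq> last p"
        using b hd_in_leaves[OF p(1,2)] last_in_leaves[OF p(1,2)] p(3,4) by auto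
      ultimately show ?thesis using hd_neq_last[OF p(1,2)] by simp
    qed
  next
    case 3
    \<comment> \<open>If \<open>a\<close> was a leaf it is discarded, but \<open>b\<close> makes up
      for it.\<close>
    have "card (leaves W F) \<le> card (insert b (leaves W F - {a}))"
      using fin(1) b by (simp add: card_Diff_singleton_if) arith
    also have "\<dots> \<le> card (leaves ?W ?F)" by (rule card_mono[OF fin(2) sub])
    finally show ?thesis using 3 by simp
  qed
qed simp

text \<open>A subtree with inclusion-maximal vertex set is spanning: otherwise a path from it to a
  missed vertex contains an edge leaving it, and attaching that edge enlarges the tree.\<close>

lemma spanning_tree_exists:
  assumes "simple_graph V E" "connected_graph V E"
  obtains F where "tree V F" "F \<subseteq> E"
proof -
  let ?Q = "\<lambda>W. W \<subseteq> V \<and> (\<exists>F\<subseteq>E. tree W F)"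
  have finV: "finite V" using assms(1) by (simp add: simple_graph_def)
  obtain v where "v \<in> V" using assms(2) by (auto simp: connected_graph_def)
  then have "?Q {v}" by (intro conjI exI[of _ "{}"]) (simp_all add: tree.single)
  moreover have "finite {W. ?Q W}"
    by (rule finite_subset[of _ "Pow V"]) (use finV in auto)
  ultimately obtain W where "W \<in> {W. ?Q W}" "\<forall>W'\<in>{W. ?Q W}. W \<subseteq> W' \<longrightarrow> W = W'"
    using finite_has_maximal[of "{W. ?Q W}"] by (metis (mono_tags, lifting) empty_iff mem_Collect_eq)
  then have W: "?Q W" and max: "\<And>W'. ?Q W' \<Longrightarrow> W \<subseteq> W' \<Longrightarrow> W = W'"
    by simp_all
  obtain F where F: "F \<subseteq> E" "tree W F" using W by blast
  have "W = V"
  proof (rule ccontr)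
    assume "W \<noteq> V"
    then obtain v where v: "v \<in> V" "v \<notin> W" using W by blast
    obtain u where u: "u \<in> W"
      using tree_connected[OF F(2)] by (auto simp: connected_graph_def)
    then obtain p where p: "path_between V E u p v"
      using assms(2) v W unfolding connected_graph_def by blast
    then obtain a b where ab: "a \<in> W" "b \<notin> W" "b \<in> set p" "{a, b} \<in> path_edges p"
      using exists_crossing_step[of p "\<lambda>x. x \<in> W"] u v by (auto simp: path_between_def)
    then have "b \<in> V" "{a, b} \<in> E" using p by (auto simp: path_between_def)
    then have "insert b W \<subseteq> V" "insert {a, b} F \<subseteq> E" using F(1) W by simp_all
    then have "?Q (insert b W)" using tree.grow[OF F(2) ab(1,2)]
      by (intro conjI exI[of _ "insert {a, b} F"])
    then have "W = insert b W" using max by (simp only: subset_insertI)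
    then show False using ab(2) by blast
  qed
  then show thesis using that F by blast
qed

section \<open>The characterization\<close>

lemma tmc_path_graph:
  assumes "simple_graph V E" "connected_graph V E" "path_graph V E"
  shows "tmc V E = 3"
proof (rule antisym)
  obtain p where p: "2 \<le> length p" "distinct p" "V = set p" "E = path_edges p"
    using assms(3) unfolding path_graph_def by blast
  show "tmc V E \<le> 3"
    using tmc_attained[OF assms(1,2)] card_colors_used_path_le p by metis
  have "E \<noteq> {}" using hd_in_leaves[OF p(1,2)] p(4) by (auto simp: leaves_def)
  \<comment> \<open>With \<open>F = E\<close> the bound becomes one plus the number of
    leaves.\<close>
  then have "1 + card (leaves V E) + card (E - E) \<le> tmc V E"
    using tmc_ge_leaves assms by blast
  then show "3 \<le> tmc V E" using path_graph_card_leaves[OF assms(3)] by simp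
qed

lemma tmc_single_vertex:
  assumes "simple_graph {v} E"
  shows "tmc {v} E = 1"
proof -
  have E: "E = {}"
    using assms by (fastforce simp: simple_graph_def card_2_iff)
  have "connected_graph {v} E" unfolding E by (rule tree_connected[OF tree.single])
  then show ?thesis
    using tmc_attained[OF assms] by (metis E Un_empty_right colors_used_def image_empty
        image_insert is_singletonI is_singleton_altdef)
qed

text \<open>The value 3 is missed from either side: \<open>tmc V E\<close> is 1 when the spanning
  tree has no edge and at least 4 when it has one.\<close>

lemma tmc_not_path_graph:
  assumes "simple_graph V E" "connected_graph V E" "\<not> path_graph V E"
  shows "tmc V E \<noteq> 3"
proof -
  obtain F where F: "tree V F" "F \<subseteq> E" using spanning_tree_exists assms(1,2) by blast
  show ?thesis
  proof (cases "F = {}")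
    case True
    then show ?thesis using tree_no_edges tmc_single_vertex F(1) assms(1) by fastforce
  next
    case False
    have ge: "1 + card (leaves V F) + card (E - F) \<le> tmc V E"
      using tmc_ge_leaves[OF assms(1) tree_connected[OF F(1)] F(2) False] .
    show ?thesis
    proof (cases "F = E")
      case True
      \<comment> \<open>The tree is the whole graph and not a path, so it has at least three
        leaves.\<close>
      then show ?thesis using ge tree_path_or_leaves[OF F(1) False] assms(3) by simp
    next
      case proper: False
      \<comment> \<open>The tree may be a path here, with only two leaves; an edge of the graph off
        the tree then supplies the fourth color.\<close>
      have "2 \<le> card (leaves V F)"
        using tree_path_or_leaves[OF F(1) False] path_graph_card_leaves by fastforce
      moreover have "card (E - F) \<noteq> 0"
        using proper F(2) simple_graph_finite_edges[OF assms(1)] by auto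
      ultimately show ?thesis using ge by simp
    qed
  qed
qed

theorem theorem3:
  fixes V :: "'a set" and E :: "'a set set"
  assumes "simple_graph V E" and "connected_graph V E"
  shows "tmc V E = 3 \<longleftrightarrow> path_graph V E"
  using tmc_path_graph tmc_not_path_graph assms by blast

end
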